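(* Let $G = G_{n,1/2}$ be the binomial random graph on vertex set $[n]=\{1,\dots,n\}$ in which each pair is an edge independently with probability $1/2$. For a positive integer $k$ let $f(k)=\binom{n}{k}2^{-\binom{k}{2}}$ (the expected number of $k$-cliques in $G$) and let $k_0=k_0(n)=\min\{k : f(k)<1\}$. Let $\nu_k(G)$ denote the maximum number of pairwise edge-disjoint $k$-cliques in $G$. Then for each fixed integer $C$ there is a constant $D$ such that, for all sufficiently large $n$, if $k=k_0-C$ then \[ \Pr\bigl(\nu_k(G) > Dn^2/k^3\bigr) < \exp[-n^2/k^2]. \]
   Context: Two cliques are edge-disjoint if they share no edge (they may share at most one vertex). $\log$ denotes the natural logarithm. *)

theory Defs
  imports "HOL-Probability.Probability" "HOL-Library.Ramsey"
begin

text \<open>A graph is given by a vertex set \<open>V\<close> together with a set \<open>E\<close> of two-element subsets of \<open>V\<close>,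
  the representation used in \<^theory>\<open>HOL-Library.Ramsey\<close>.\<close>

definition random_graph :: "nat \<Rightarrow> real \<Rightarrow> nat set set pmf" where
  "random_graph n p =
     map_pmf (\<lambda>\<omega>. {e \<in> nsets {1..n} 2. \<omega> e}) (Pi_pmf (nsets {1..n} 2) False (\<lambda>_. bernoulli_pmf p))"

definition k_cliques :: "'a set \<Rightarrow> 'a set set \<Rightarrow> nat \<Rightarrow> 'a set set" where
  "k_cliques V E k = {K \<in> nsets V k. clique K E}"

definition edge_disjoint :: "'a set \<Rightarrow> 'a set \<Rightarrow> bool" where
  "edge_disjoint K L \<longleftrightarrow> nsets K 2 \<inter> nsets L 2 = {}"

definition clique_packing_number :: "'a set \<Rightarrow> 'a set set \<Rightarrow> nat \<Rightarrow> nat" where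
  "clique_packing_number V E k =
     Max {card F | F. F \<subseteq> k_cliques V E k \<and> pairwise edge_disjoint F}"

definition expected_cliques :: "nat \<Rightarrow> nat \<Rightarrow> real" where
  "expected_cliques n k = real (n choose k) * 2 powi (- int (k choose 2))"

text \<open>The minimum is always attained, as \<^term>\<open>expected_cliques n k = 0\<close> for \<open>k > n\<close>.\<close>

definition k_zero :: "nat \<Rightarrow> nat" where
  "k_zero n = (LEAST k. 1 \<le> k \<and> expected_cliques n k < 1)"

end

theory Submission
  imports Defs "HOL-Real_Asymp.Real_Asymp"
begin

text \<open>By a union bound it suffices to count the edge-disjoint families of \<open>t\<close> sets of size \<open>k\<close>: their number
  is at most \<open>(n choose k)^t\<close>, and since \<open>f(k) \<le> exp (O(k))\<close> one has to gain a factor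
  \<open>exp (- c k t)\<close> with \<open>c\<close> large when \<open>D\<close> is large. The family is built one set at a time. In the second
  half of the process a new set has to be independent in the union \<open>H\<close> of the cliques chosen so far,
  and by averaging the order can be chosen so that at least half of its vertices lie in the set \<open>U\<close>
  of vertices whose number of cliques is a fixed fraction of the average. As \<open>H\<close> is a union of edge-disjoint
  cliques, Cauchy--Schwarz shows that every subset of \<open>U\<close> with more than \<open>n exp (- c)\<close> vertices has a
  vertex with many neighbours inside it. A Kleitman--Winston type argument, phrased as a bound on
  the independence polynomial of \<open>H\<close> with weight \<open>exp c * k / n\<close> on \<open>U\<close> and \<open>k / n\<close> elsewhere, then
  bounds the number of choices for the new set by \<open>(n choose k) exp ((3 - c / 2) k)\<close>.\<close>

section \<open>A weighted count of independent sets\<close>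

definition indep :: "('a \<Rightarrow> 'a \<Rightarrow> bool) \<Rightarrow> 'a set \<Rightarrow> bool" where
  "indep adj I \<longleftrightarrow> (\<forall>u\<in>I. \<forall>v\<in>I. u \<noteq> v \<longrightarrow> \<not> adj u v)"

text \<open>The multivariate independence polynomial (hard-core partition function) of the graph
  induced on \<open>T\<close>.\<close>

definition part_fun :: "('a \<Rightarrow> 'a \<Rightarrow> bool) \<Rightarrow> ('a \<Rightarrow> real) \<Rightarrow> 'a set \<Rightarrow> real" where
  "part_fun adj w T = (\<Sum>I | I \<subseteq> T \<and> indep adj I. prod w I)"

text \<open>Without the independence condition the sum is the expanded product of the factors 1 +
  \<open>w v\<close>.\<close>

lemma part_fun_le_exp_sum:
  assumes "finite T" and w: "\<And>v. v \<in> T \<Longrightarrow> 0 \<le> w v"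
  shows "part_fun adj w T \<le> exp (sum w T)"
proof -
  have "part_fun adj w T \<le> (\<Sum>I\<in>Pow T. prod w I)"
    unfolding part_fun_def using assms by (intro sum_mono2 prod_nonneg) auto
  also have "\<dots> = (\<Prod>v\<in>T. w v + 1)"
    using assms(1) by (simp add: prod_add)
  also have "\<dots> \<le> (\<Prod>v\<in>T. exp (w v))"
    using w by (intro prod_mono) (auto simp: add.commute exp_ge_add_one_self add_nonneg_nonneg)
  finally show ?thesis by (simp add: exp_sum assms(1))
qed

text \<open>Split the independent sets by whether they contain \<open>v\<close>; those that do avoid
  all its neighbours. Since \<open>adj\<close> need not be symmetric, the right-hand side may
  overcount.\<close>

lemma part_fun_recurrence:
  assumes fin: "finite T" and v: "v \<in> T" and w: "\<And>u. u \<in> T \<Longrightarrow> 0 \<le> w u"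
  shows "part_fun adj w T \<le> part_fun adj w (T - {v})
           + w v * part_fun adj w (T - {v} - {u. adj v u})"
proof -
  let ?A = "{I. I \<subseteq> T - {v} \<and> indep adj I}"
  let ?B = "{I. I \<subseteq> T - {v} - {u. adj v u} \<and> indep adj I}"
  have finAB: "finite ?A" "finite ?B" using fin by auto
  have "part_fun adj w T \<le> (\<Sum>I\<in>?A \<union> insert v ` ?B. prod w I)"
    unfolding part_fun_def
  proof (rule sum_mono2)
    show "{I. I \<subseteq> T \<and> indep adj I} \<subseteq> ?A \<union> insert v ` ?B"
    proof
      fix I assume I: "I \<in> {I. I \<subseteq> T \<and> indep adj I}"
      show "I \<in> ?A \<union> insert v ` ?B"
      proof (cases "v \<in> I")
        case True
        have "I - {v} \<in> ?B"
          using I True by (auto simp: indep_def)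
        moreover have "I = insert v (I - {v})" using True by auto
        ultimately show ?thesis by blast
      qed (use I in auto)
    qed
  qed (use finAB w v in \<open>auto intro!: prod_nonneg\<close>)
  also have "\<dots> = (\<Sum>I\<in>?A. prod w I) + (\<Sum>I\<in>insert v ` ?B. prod w I)"
    using finAB by (intro sum.union_disjoint) auto
  also have "(\<Sum>I\<in>insert v ` ?B. prod w I) = (\<Sum>I\<in>?B. prod w (insert v I))"
    by (subst sum.reindex) (auto simp: inj_on_def)
  also have "\<dots> = (\<Sum>I\<in>?B. w v * prod w I)"
  proof (rule sum.cong)
    fix I assume "I \<in> ?B"
    then have "finite I" "v \<notin> I" using fin finite_subset by auto
    then show "prod w (insert v I) = w v * prod w I" by simp
  qed simp
  finally show ?thesis by (simp add: part_fun_def sum_distrib_left)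
qed

text \<open>A Kleitman--Winston type bound: deleting a vertex of high degree together with its neighbours
  pays for the growth of the partition function until few vertices of \<open>U\<close> remain.\<close>

lemma part_fun_le_exp:
  fixes w :: "'a \<Rightarrow> real"
  assumes "finite T" and w: "\<And>v. 0 \<le> w v" and "0 \<le> \<mu>"
    and small: "\<And>S. S \<subseteq> T \<Longrightarrow> real (card (S \<inter> U)) \<le> R \<Longrightarrow> sum w S \<le> A"
    and large: "\<And>S. S \<subseteq> T \<Longrightarrow> real (card (S \<inter> U)) > R \<Longrightarrow>
                  \<exists>v\<in>S \<inter> U. real (card {u \<in> S \<inter> U. u \<noteq> v \<and> adj v u}) \<ge> d"
    and wU: "\<And>v. v \<in> U \<Longrightarrow> w v * exp (- (\<mu> * d)) \<le> \<mu>"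
  shows "part_fun adj w T \<le> exp (A + \<mu> * real (card (T \<inter> U)))"
  using \<open>finite T\<close> small large
proof (induction "card T" arbitrary: T rule: less_induct)
  case less
  show ?case
  proof (cases "real (card (T \<inter> U)) \<le> R")
    case True
    have "part_fun adj w T \<le> exp (sum w T)"
      using part_fun_le_exp_sum less.prems(1) w by blast
    also have "\<dots> \<le> exp (A + \<mu> * real (card (T \<inter> U)))"
      using less.prems(2)[of T] True \<open>0 \<le> \<mu>\<close> by (simp add: add_increasing2)
    finally show ?thesis .
  next
    case False
    then obtain v where v: "v \<in> T" "v \<in> U"
      and deg: "real (card {u \<in> T \<inter> U. u \<noteq> v \<and> adj v u}) \<ge> d"
      using less.prems(3)[of T] by auto
    have IH: "part_fun adj w S \<le> exp (A + \<mu> * real (card (S \<inter> U)))" if "S \<subset> T" for S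
      using that less.prems by (intro less.hyps) (auto intro: psubset_card_mono finite_subset)
    let ?s = "real (card (T \<inter> U))"
    let ?S = "T - {v} - {u. adj v u}"
    let ?N = "{u \<in> T \<inter> U. u \<noteq> v \<and> adj v u}"
    have "T \<inter> U = insert v ((T - {v}) \<inter> U)" using v by auto
    then have c1: "card (T \<inter> U) = Suc (card ((T - {v}) \<inter> U))"
      using less.prems(1) by (metis DiffD2 IntD1 card_insert_disjoint finite_Diff finite_Int singletonI)
    have "(T - {v}) \<inter> U = ?N \<union> (?S \<inter> U)" by auto
    moreover have "?N \<inter> (?S \<inter> U) = {}" by auto
    ultimately have c2: "card ((T - {v}) \<inter> U) = card ?N + card (?S \<inter> U)"
      using less.prems(1) by (simp add: card_Un_disjoint)
    have "part_fun adj w T \<le> part_fun adj w (T - {v}) + w v * part_fun adj w ?S"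
      using part_fun_recurrence less.prems(1) v w by metis
    also have "\<dots> \<le> exp (A + \<mu> * (?s - 1)) + w v * exp (A + \<mu> * (?s - 1) - \<mu> * d)"
    proof (intro add_mono mult_left_mono)
      show "part_fun adj w (T - {v}) \<le> exp (A + \<mu> * (?s - 1))"
        using IH[of "T - {v}"] v c1 by auto
      \<comment> \<open>Besides \<open>v\<close> itself at least \<open>d\<close> neighbours leave
        \<open>U\<close>, which yields the saving exp (- \<mu> d).\<close>
      have "real (card (?S \<inter> U)) \<le> ?s - 1 - d" using c1 c2 deg by simp
      then have "\<mu> * real (card (?S \<inter> U)) \<le> \<mu> * (?s - 1) - \<mu> * d"
        using \<open>0 \<le> \<mu>\<close> by (metis mult_left_mono right_diff_distrib)
      then have "exp (A + \<mu> * real (card (?S \<inter> U))) \<le> exp (A + \<mu> * (?s - 1) - \<mu> * d)" by simp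
      moreover have "?S \<subset> T" using v by auto
      note IH[OF this]
      ultimately show "part_fun adj w ?S \<le> exp (A + \<mu> * (?s - 1) - \<mu> * d)"
        by (rule order_trans[rotated])
    qed (use w in auto)
    also have "\<dots> = exp (A + \<mu> * (?s - 1)) * (1 + w v * exp (- (\<mu> * d)))"
      by (simp add: distrib_left exp_diff exp_minus divide_inverse)
    \<comment> \<open>By \<open>wU\<close> the bracket is at most 1 + \<mu>, and one vertex of
      \<open>U\<close> may cost a factor exp \<mu>.\<close>
    also have "\<dots> \<le> exp (A + \<mu> * (?s - 1)) * exp \<mu>"
      using order_trans[OF add_left_mono[OF wU[OF v(2)], of 1] exp_ge_add_one_self[of \<mu>]]
      by (intro mult_left_mono) auto
    also have "\<dots> = exp (A + \<mu> * ?s)" by (simp add: exp_add[symmetric] algebra_simps)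
    finally show ?thesis .
  qed
qed

section \<open>Edge-disjoint families\<close>

definition fdeg :: "'a set set \<Rightarrow> 'a \<Rightarrow> nat" where
  "fdeg F v = card {K \<in> F. v \<in> K}"

text \<open>Adjacency in the union of the cliques on the members of \<open>F\<close>. A covered
  vertex is joined to itself, so degree counts demand distinct vertices explicitly.\<close>

definition joined :: "'a set set \<Rightarrow> 'a \<Rightarrow> 'a \<Rightarrow> bool" where
  "joined F u v \<longleftrightarrow> (\<exists>K\<in>F. u \<in> K \<and> v \<in> K)"

lemma sum_fdeg:
  assumes "finite F" "finite S"
  shows "(\<Sum>v\<in>S. fdeg F v) = (\<Sum>K\<in>F. card (K \<inter> S))"
proof -
  have "(\<Sum>v\<in>S. fdeg F v) = (\<Sum>K\<in>F. card {v \<in> S. v \<in> K})"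
    unfolding fdeg_def using sum_multicount_gen[OF assms(2,1), of "\<lambda>v K. v \<in> K"] by simp
  also have "\<dots> = (\<Sum>K\<in>F. card (K \<inter> S))"
    by (intro sum.cong arg_cong[where f = card]) auto
  finally show ?thesis .
qed

lemma edge_disjoint_unique:
  assumes "pairwise edge_disjoint F" "K \<in> F" "L \<in> F" "u \<in> K" "v \<in> K" "u \<in> L" "v \<in> L" "u \<noteq> v"
  shows "K = L"
proof (rule ccontr)
  assume "K \<noteq> L"
  then have "nsets K 2 \<inter> nsets L 2 = {}"
    using assms unfolding pairwise_def edge_disjoint_def by blast
  moreover have "{u, v} \<in> nsets K 2" "{u, v} \<in> nsets L 2" using assms by auto
  ultimately show False by blast
qed

text \<open>By edge-disjointness each ordered pair of distinct joined vertices lies in exactly one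
  member of \<open>F\<close>, so the pairs split into disjoint blocks, one per member.\<close>

lemma sum_joined_degrees:
  assumes ed: "pairwise edge_disjoint F" and "finite F" "finite S"
  shows "(\<Sum>v\<in>S. card {u \<in> S. u \<noteq> v \<and> joined F v u})
          = (\<Sum>K\<in>F. card (K \<inter> S) * (card (K \<inter> S) - 1))"
proof -
  let ?B = "\<lambda>K. SIGMA v:K \<inter> S. K \<inter> S - {v}"
  have "(\<Sum>v\<in>S. card {u \<in> S. u \<noteq> v \<and> joined F v u})
         = card (SIGMA v:S. {u \<in> S. u \<noteq> v \<and> joined F v u})"
    using assms by simp
  also have "(SIGMA v:S. {u \<in> S. u \<noteq> v \<and> joined F v u}) = (\<Union>K\<in>F. ?B K)"
    unfolding joined_def by auto
  also have "card \<dots> = (\<Sum>K\<in>F. card (?B K))"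
    using assms edge_disjoint_unique[OF ed] by (intro card_UN_disjoint) auto
  also have "\<dots> = (\<Sum>K\<in>F. card (K \<inter> S) * (card (K \<inter> S) - 1))"
    using assms by (intro sum.cong) (auto simp: card_Diff_singleton)
  finally show ?thesis .
qed

text \<open>By Cauchy--Schwarz a union of edge-disjoint cliques has no large sparse set of vertices of
  high degree, although a general graph of the same density may have one.\<close>

lemma exists_joined_degree_ge:
  fixes \<theta> :: real
  assumes ed: "pairwise edge_disjoint F" and fin: "finite F" "finite S" and "F \<noteq> {}"
    and deg: "\<And>v. v \<in> S \<Longrightarrow> \<theta> \<le> real (fdeg F v)" and "0 \<le> \<theta>"
    and large: "2 * real (card F) \<le> \<theta> * real (card S)"
  shows "\<exists>v\<in>S. \<theta>\<^sup>2 * real (card S) / (2 * real (card F))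
           \<le> real (card {u \<in> S. u \<noteq> v \<and> joined F v u})"
proof (rule ccontr)
  let ?m = "real (card F)"
  let ?s = "real (card S)"
  let ?a = "\<lambda>K. real (card (K \<inter> S))"
  define x where "x = (\<Sum>K\<in>F. ?a K)"
  assume "\<not> ?thesis"
  then have less: "real (card {u \<in> S. u \<noteq> v \<and> joined F v u}) < \<theta>\<^sup>2 * ?s / (2 * ?m)" if "v \<in> S" for v
    using that by force
  have m: "?m > 0" using fin \<open>F \<noteq> {}\<close> by (simp add: card_gt_0_iff)
  have "S \<noteq> {}" using large m by auto
  have "x = (\<Sum>v\<in>S. real (fdeg F v))"
    unfolding x_def using sum_fdeg[OF fin] by (metis of_nat_sum)
  also have "\<dots> \<ge> (\<Sum>v\<in>S. \<theta>)" by (intro sum_mono deg)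
  finally have x: "\<theta> * ?s \<le> x" by (simp add: mult.commute)
  \<comment> \<open>The hypothesis \<open>large\<close> gives x \<ge> 2 |F|, so removing the
    diagonal contribution x costs at most half of the Cauchy-Schwarz bound x^2 / |F|.\<close>
  have "x * (x - 2 * ?m) \<ge> 0" using x large m by (intro mult_nonneg_nonneg) auto
  then have "x\<^sup>2 / (2 * ?m) \<le> x\<^sup>2 / ?m - x"
    using m by (simp add: field_simps power2_eq_square)
  also have "x\<^sup>2 / ?m \<le> (\<Sum>K\<in>F. (?a K)\<^sup>2)"
    using sum_squared_le_sum_of_squares[of ?a F] m fin by (simp add: x_def field_simps)
  also have "(\<Sum>K\<in>F. (?a K)\<^sup>2) - x = (\<Sum>K\<in>F. real (card (K \<inter> S) * (card (K \<inter> S) - 1)))"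
    unfolding x_def sum_subtractf[symmetric]
  proof (rule sum.cong)
    show "(?a K)\<^sup>2 - ?a K = real (card (K \<inter> S) * (card (K \<inter> S) - 1))" for K
      by (cases "card (K \<inter> S)") (auto simp: power2_eq_square algebra_simps)
  qed simp
  also have "\<dots> = (\<Sum>v\<in>S. real (card {u \<in> S. u \<noteq> v \<and> joined F v u}))"
    unfolding of_nat_sum[symmetric] sum_joined_degrees[OF ed fin] ..
  also have "\<dots> < (\<Sum>v\<in>S. \<theta>\<^sup>2 * ?s / (2 * ?m))"
    using fin \<open>S \<noteq> {}\<close> less by (intro sum_strict_mono) auto
  also have "\<dots> = (\<theta> * ?s)\<^sup>2 / (2 * ?m)" by (simp add: power2_eq_square)
  also have "\<dots> \<le> x\<^sup>2 / (2 * ?m)"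
    using x m \<open>0 \<le> \<theta>\<close> by (intro divide_right_mono power_mono) auto
  finally show False by simp
qed

section \<open>Counting packings by adding one set at a time\<close>

definition packings :: "'a set \<Rightarrow> nat \<Rightarrow> nat \<Rightarrow> 'a set set set" where
  "packings V k t = {F. F \<subseteq> nsets V k \<and> pairwise edge_disjoint F \<and> card F = t}"

text \<open>Candidates for the next set in the second half of the process. The degree condition is
  what makes them few, and \<open>exists_extension\<close> shows that a suitable last set can always
  be found.\<close>

definition extensions :: "'a set \<Rightarrow> nat \<Rightarrow> real \<Rightarrow> 'a set set \<Rightarrow> 'a set set" where
  "extensions V k \<theta> F = {K \<in> nsets V k. (\<forall>L\<in>F. edge_disjoint K L) \<and>
     real k \<le> 2 * real (card {v \<in> K. \<theta> \<le> real (fdeg F v)})}"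

lemma finite_packings: "finite V \<Longrightarrow> finite (packings V k t)"
  by (rule finite_subset[of _ "Pow (nsets V k)"])
    (auto simp: packings_def finite_imp_finite_nsets)

lemma finite_packing: "finite V \<Longrightarrow> F \<in> packings V k t \<Longrightarrow> finite F"
  unfolding packings_def using finite_imp_finite_nsets finite_subset by blast

lemma packing_remove:
  assumes "finite V" "F \<in> packings V k (Suc m)" "K \<in> F"
  shows "F - {K} \<in> packings V k m"
  using assms finite_packing[OF assms(1,2)]
  by (auto simp: packings_def intro: pairwise_mono)

text \<open>The removed set may be chosen depending on \<open>F\<close>: every larger packing arises
  by inserting some \<open>K\<close> from \<open>X (F - {K})\<close>, so it suffices to count the
  pairs.\<close>

lemma card_packings_Suc_le:
  assumes V: "finite V"
    and ex: "\<And>F. F \<in> packings V k (Suc m) \<Longrightarrow> \<exists>K\<in>F. K \<in> X (F - {K})"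
    and X: "\<And>F. F \<in> packings V k m \<Longrightarrow> finite (X F) \<and> real (card (X F)) \<le> M"
  shows "real (card (packings V k (Suc m))) \<le> real (card (packings V k m)) * M"
proof -
  let ?P = "packings V k m"
  have "packings V k (Suc m) \<subseteq> (\<lambda>(F, K). insert K F) ` Sigma ?P X"
  proof
    fix F assume F: "F \<in> packings V k (Suc m)"
    then obtain K where K: "K \<in> F" "K \<in> X (F - {K})" using ex by blast
    have "F = (\<lambda>(F, K). insert K F) (F - {K}, K)" using K by auto
    moreover have "(F - {K}, K) \<in> Sigma ?P X" using K packing_remove[OF V F] by auto
    ultimately show "F \<in> (\<lambda>(F, K). insert K F) ` Sigma ?P X" by (rule image_eqI)
  qed
  moreover have fin: "finite (Sigma ?P X)" using X finite_packings[OF V] by blast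
  ultimately have "card (packings V k (Suc m)) \<le> card (Sigma ?P X)"
    by (meson card_image_le card_mono finite_imageI order_trans)
  also have "card (Sigma ?P X) = (\<Sum>F\<in>?P. card (X F))"
    using X finite_packings[OF V] by (intro card_SigmaI) auto
  finally have "real (card (packings V k (Suc m))) \<le> (\<Sum>F\<in>?P. real (card (X F)))"
    by (metis of_nat_le_iff of_nat_sum)
  also have "\<dots> \<le> (\<Sum>F\<in>?P. M)" using X by (intro sum_mono) blast
  finally show ?thesis by simp
qed

text \<open>The crude count, allowing any k-set at each step; it serves for the first half of the
  process.\<close>

lemma card_packings_le_power:
  assumes V: "finite V"
  shows "real (card (packings V k t)) \<le> real (card V choose k) ^ t"
proof (induction t)
  case 0
  have "F = {}" if "F \<in> packings V k 0" for F
    using that finite_packing[OF V that] by (simp add: packings_def)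
  then have "packings V k 0 \<subseteq> {{}}" by blast
  from card_mono[OF _ this] have "card (packings V k 0) \<le> 1" by simp
  then show ?case by simp
next
  case (Suc t)
  have "real (card (packings V k (Suc t))) \<le> real (card (packings V k t)) * real (card V choose k)"
  proof (rule card_packings_Suc_le[OF V])
    fix F assume "F \<in> packings V k (Suc t)"
    then have "F \<noteq> {}" "F \<subseteq> nsets V k" by (auto simp: packings_def)
    then show "\<exists>K\<in>F. K \<in> (\<lambda>_. nsets V k) (F - {K})" by auto
  qed (use V finite_imp_finite_nsets in auto)
  also have "\<dots> \<le> real (card V choose k) ^ t * real (card V choose k)"
    using Suc by (intro mult_right_mono) auto
  finally show ?case by (simp add: mult.commute)
qed

text \<open>Averaging: low-degree vertices carry at most half of the incidences, so some member of the
  family has at least half of its vertices of high degree even after its own removal.\<close>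

lemma exists_extension:
  assumes V: "finite V" and F: "F \<in> packings V k (Suc m)" and "0 \<le> \<theta>"
    and small: "2 * real (card V) * (\<theta> + 1) < real (Suc m) * real k"
  shows "\<exists>K\<in>F. K \<in> extensions V k \<theta> (F - {K})"
proof (rule ccontr)
  assume neg: "\<not> ?thesis"
  \<comment> \<open>For \<open>v\<close> in \<open>K\<close> the removal of \<open>K\<close> lowers
    the degree by exactly one, so degree below \<theta> + 1 in \<open>F\<close> means degree below
    \<theta> in \<open>F - {K}\<close>.\<close>
  let ?S = "{v \<in> V. real (fdeg F v) < \<theta> + 1}"
  have finF: "finite F" using V F by (rule finite_packing)
  have FV: "F \<subseteq> nsets V k" and ed: "pairwise edge_disjoint F" and cF: "card F = Suc m"
    using F by (auto simp: packings_def)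
  have low: "real k / 2 \<le> real (card (K \<inter> ?S))" if K: "K \<in> F" for K
  proof -
    have KV: "K \<subseteq> V" "finite K" "card K = k" using K FV by (auto simp: nsets_def)
    have deg: "fdeg F v = Suc (fdeg (F - {K}) v)" if "v \<in> K" for v
    proof -
      have "{L \<in> F. v \<in> L} = insert K {L \<in> F - {K}. v \<in> L}" using K that by auto
      then show ?thesis unfolding fdeg_def using finF by simp
    qed
    have "K \<notin> extensions V k \<theta> (F - {K})" using neg K by blast
    moreover have "\<forall>L\<in>F - {K}. edge_disjoint K L" using ed K by (auto simp: pairwise_def)
    ultimately have "2 * real (card {v \<in> K. \<theta> \<le> real (fdeg (F - {K}) v)}) < real k"
      using K FV unfolding extensions_def by auto
    moreover have "K \<inter> ?S = K - {v \<in> K. \<theta> \<le> real (fdeg (F - {K}) v)}"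
      using KV deg by auto
    then have "real (card (K \<inter> ?S)) = real k - real (card {v \<in> K. \<theta> \<le> real (fdeg (F - {K}) v)})"
      using KV card_mono[of K "{v \<in> K. \<theta> \<le> real (fdeg (F - {K}) v)}"]
      by (simp add: card_Diff_subset)
    ultimately show ?thesis by simp
  qed
  have "real (Suc m) * (real k / 2) \<le> (\<Sum>K\<in>F. real (card (K \<inter> ?S)))"
    using sum_mono[OF low, of F] cF by (simp add: mult.commute)
  also have "\<dots> = (\<Sum>v\<in>?S. real (fdeg F v))"
    using sum_fdeg[OF finF, of ?S] V by (simp flip: of_nat_sum)
  also have "\<dots> \<le> (\<Sum>v\<in>?S. \<theta> + 1)" by (intro sum_mono) auto
  also have "\<dots> \<le> (\<Sum>v\<in>V. \<theta> + 1)" using V \<open>0 \<le> \<theta>\<close> by (intro sum_mono2) auto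
  finally show False using small by (simp add: algebra_simps)
qed

text \<open>Extensions are independent in \<open>joined F\<close>, and each weighs at least (k/n)^k
  exp (c k / 2), while the partition function is at most exp (3 k). Here \<open>h1\<close> lets
  Cauchy-Schwarz apply to sets with more than n / exp c vertices in \<open>U\<close>, and
  \<open>h2\<close> makes the resulting degree large enough to pay for the weight exp c.\<close>

lemma card_extensions_le:
  fixes c \<theta> :: real and k m :: nat
  assumes V: "finite V" and F: "F \<in> packings V k m" and "0 < m"
    and k: "0 < k" "k \<le> card V" and "0 \<le> c" "0 \<le> \<theta>"
    and h1: "2 * real m \<le> \<theta> * (real (card V) / exp c)"
    and h2: "c \<le> real k / real (card V) * (\<theta>\<^sup>2 * (real (card V) / exp c) / (2 * real m))"
  shows "real (card (extensions V k \<theta> F)) \<le> real (card V choose k) * exp ((3 - c / 2) * real k)"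
proof -
  define n where "n = real (card V)"
  \<comment> \<open>With this cutoff the vertices of \<open>U\<close> in a small set weigh at most R
    \<kappa> exp c = k, as much as the base weight \<kappa> n of all vertices.\<close>
  define R where "R = n / exp c"
  define \<kappa> where "\<kappa> = real k / n"
  define U where "U = {v \<in> V. \<theta> \<le> real (fdeg F v)}"
  define w where "w = (\<lambda>v. if v \<in> U then \<kappa> * exp c else \<kappa>)"
  define d where "d = \<theta>\<^sup>2 * R / (2 * real m)"
  have n: "n > 0" using k by (simp add: n_def)
  have \<kappa>: "\<kappa> > 0" using k n by (simp add: \<kappa>_def)
  have finF: "finite F" using V F by (rule finite_packing)
  have ed: "pairwise edge_disjoint F" and cF: "card F = m" using F by (auto simp: packings_def)
  \<comment> \<open>Used with \<mu> = \<kappa> and A = 2 k; the remaining term \<kappa> |U| is at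
    most another k.\<close>
  have "part_fun (joined F) w V \<le> exp (2 * real k + \<kappa> * real (card (V \<inter> U)))"
  proof (rule part_fun_le_exp[where R = R and d = d])
    fix S assume S: "S \<subseteq> V" "real (card (S \<inter> U)) \<le> R"
    have finS: "finite S" using S V finite_subset by blast
    have "sum w S = (\<Sum>v\<in>S \<inter> U. w v) + (\<Sum>v\<in>S - U. w v)"
      using finS by (rule sum.Int_Diff)
    also have "\<dots> = (\<Sum>v\<in>S \<inter> U. \<kappa> * exp c) + (\<Sum>v\<in>S - U. \<kappa>)"
      by (intro arg_cong2[where f = "(+)"] sum.cong) (auto simp: w_def)
    also have "\<dots> = real (card (S \<inter> U)) * (\<kappa> * exp c) + real (card (S - U)) * \<kappa>" by simp
    also have "\<dots> \<le> R * (\<kappa> * exp c) + n * \<kappa>"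
      using S \<kappa> V unfolding n_def by (intro add_mono mult_right_mono) (auto intro!: card_mono)
    also have "\<dots> = 2 * real k" using n by (simp add: R_def \<kappa>_def)
    finally show "sum w S \<le> 2 * real k" .
  next
    fix S assume S: "S \<subseteq> V" "R < real (card (S \<inter> U))"
    have "2 * real m \<le> \<theta> * real (card (S \<inter> U))"
      using h1 mult_left_mono[OF less_imp_le[OF S(2)] \<open>0 \<le> \<theta>\<close>]
      unfolding R_def n_def by (rule order_trans)
    then have *: "2 * real (card F) \<le> \<theta> * real (card (S \<inter> U))" using cF by simp
    have ne: "F \<noteq> {}" using cF \<open>0 < m\<close> by auto
    have fin: "finite (S \<inter> U)" using finite_subset[OF S(1) V] by simp
    have deg: "\<theta> \<le> real (fdeg F v)" if "v \<in> S \<inter> U" for v using that by (simp add: U_def)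
    have "\<exists>v\<in>S \<inter> U. \<theta>\<^sup>2 * real (card (S \<inter> U)) / (2 * real m)
        \<le> real (card {u \<in> S \<inter> U. u \<noteq> v \<and> joined F v u})"
      using exists_joined_degree_ge[OF ed finF fin ne deg \<open>0 \<le> \<theta>\<close> *] unfolding cF .
    moreover have "d \<le> \<theta>\<^sup>2 * real (card (S \<inter> U)) / (2 * real m)"
      unfolding d_def using S by (intro divide_right_mono mult_left_mono) auto
    ultimately show "\<exists>v\<in>S \<inter> U. d \<le> real (card {u \<in> S \<inter> U. u \<noteq> v \<and> joined F v u})"
      by force
  next
    fix v assume "v \<in> U"
    have "exp c * exp (- (\<kappa> * d)) \<le> 1"
      using h2 by (simp add: mult_exp_exp \<kappa>_def d_def R_def n_def)
    then show "w v * exp (- (\<kappa> * d)) \<le> \<kappa>"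
      using \<open>v \<in> U\<close> \<kappa> by (simp add: w_def mult.assoc)
  qed (use V \<kappa> in \<open>auto simp: w_def\<close>)
  also have "\<dots> \<le> exp (3 * real k)"
  proof -
    have "\<kappa> * real (card (V \<inter> U)) \<le> \<kappa> * n"
      using V \<kappa> unfolding n_def by (intro mult_left_mono) (auto intro!: card_mono)
    then show ?thesis using n by (simp add: \<kappa>_def)
  qed
  finally have Z: "part_fun (joined F) w V \<le> exp (3 * real k)" .
  let ?E = "extensions V k \<theta> F"
  have "real (card ?E) * (\<kappa> ^ k * exp (c * real k / 2)) = (\<Sum>K\<in>?E. \<kappa> ^ k * exp (c * real k / 2))"
    by simp
  also have "\<dots> \<le> (\<Sum>K\<in>?E. prod w K)"
  proof (rule sum_mono)
    fix K assume "K \<in> ?E"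
    then have K: "K \<subseteq> V" "finite K" "card K = k"
      and half: "real k \<le> 2 * real (card {v \<in> K. \<theta> \<le> real (fdeg F v)})"
      by (auto simp: extensions_def nsets_def)
    have "{v \<in> K. \<theta> \<le> real (fdeg F v)} = K \<inter> U" using K by (auto simp: U_def)
    then have "c * real k / 2 \<le> c * real (card (K \<inter> U))"
      using half \<open>0 \<le> c\<close> by (auto simp: mult_left_mono simp flip: times_divide_eq_right)
    then have "\<kappa> ^ k * exp (c * real k / 2) \<le> \<kappa> ^ k * exp (c * real (card (K \<inter> U)))"
      using \<kappa> by simp
    also have "\<dots> = \<kappa> ^ k * exp c ^ card (K \<inter> U)"
      by (simp add: mult.commute flip: exp_of_nat_mult)
    also have "\<dots> = (\<Prod>v\<in>K. \<kappa> * (if v \<in> U then exp c else 1))"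
      using K by (simp add: prod.distrib prod.If_cases)
    also have "\<dots> = prod w K" by (intro prod.cong) (auto simp: w_def)
    finally show "\<kappa> ^ k * exp (c * real k / 2) \<le> prod w K" .
  qed
  also have "\<dots> \<le> part_fun (joined F) w V"
    unfolding part_fun_def
  proof (rule sum_mono2)
    show "?E \<subseteq> {I. I \<subseteq> V \<and> indep (joined F) I}"
    proof
      fix K assume K: "K \<in> ?E"
      have "\<not> joined F u v" if uv: "u \<in> K" "v \<in> K" "u \<noteq> v" for u v
      proof
        assume "joined F u v"
        then obtain L where L: "L \<in> F" "u \<in> L" "v \<in> L" by (auto simp: joined_def)
        then have "{u, v} \<in> nsets K 2 \<inter> nsets L 2" using uv by auto
        moreover have "edge_disjoint K L" using K L(1) by (simp add: extensions_def)
        ultimately show False by (simp only: edge_disjoint_def empty_iff)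
      qed
      then show "K \<in> {I. I \<subseteq> V \<and> indep (joined F) I}"
        using K by (auto simp: extensions_def nsets_def indep_def)
    qed
  qed (use V \<kappa> in \<open>auto intro!: prod_nonneg simp: w_def\<close>)
  also note Z
  finally have "real (card ?E) \<le> exp (3 * real k) / (\<kappa> ^ k * exp (c * real k / 2))"
    using \<kappa> by (simp add: pos_le_divide_eq)
  also have "\<dots> = (n / real k) ^ k * exp ((3 - c / 2) * real k)"
    using n k by (simp add: \<kappa>_def power_divide exp_diff left_diff_distrib)
  also have "\<dots> \<le> real (card V choose k) * exp ((3 - c / 2) * real k)"
    using binomial_ge_n_over_k_pow_k[OF k(2), where 'a = real] by (simp add: n_def)
  finally show ?thesis .
qed

text \<open>The first half of the sets is counted crudely; each of the remaining at least t / 2 sets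
  gains the factor exp ((3 - c / 2) k), which is at most 1 because c \<ge> 6.\<close>

lemma card_packings_le:
  fixes c :: real and k t :: nat
  assumes V: "finite V" and k: "0 < k" "real k ^ 2 \<le> real (card V)" and t: "2 \<le> t"
    and c: "6 \<le> c" "8 * exp c \<le> real k"
    and tk: "128 * c * exp c * real (card V) ^ 2 \<le> real t * real k ^ 3"
  shows "real (card (packings V k t))
           \<le> real (card V choose k) ^ t * exp ((3 - c / 2) * real k * (real t / 2))"
proof -
  define n where "n = real (card V)"
  have "real k * 1 \<le> real k ^ 2" unfolding power2_eq_square using k by (intro mult_left_mono) auto
  then have kn: "k \<le> card V" using k by linarith
  have n: "n > 0" "n \<noteq> 0" using kn k by (auto simp: n_def)
  let ?B = "real (card V choose k) * exp ((3 - c / 2) * real k)"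
  have step: "real (card (packings V k (Suc m))) \<le> real (card (packings V k m)) * ?B"
    if m: "t \<le> 4 * m" for m
  proof -
    \<comment> \<open>A quarter of the average degree m k / n of a packing of m sets.\<close>
    define \<theta> where "\<theta> = real m * real k / (4 * n)"
    have "m > 0" using m t by simp
    have \<theta>0: "\<theta> \<ge> 0" using n by (simp add: \<theta>_def)
    have m4: "real t * real k ^ 3 \<le> 4 * real m * real k ^ 3" using m by (intro mult_right_mono) auto
    have e: "1 * 1 \<le> c * exp c" using c by (intro mult_mono) auto
    show ?thesis
    proof (rule card_packings_Suc_le[OF V, where X = "extensions V k \<theta>"])
      fix F assume F: "F \<in> packings V k (Suc m)"
      \<comment> \<open>This absorbs the +1 in the averaging lemma: 2 n (\<theta> + 1) = m k / 2 + 2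
        n is then at most m k.\<close>
      have "4 * n \<le> real m * real k"
      proof -
        have "16 * n * real k ^ 2 \<le> 16 * n * n"
          using k n by (intro mult_left_mono) (auto simp: n_def)
        also have "\<dots> \<le> 128 * (n * n)" by simp
        also have "\<dots> \<le> 128 * (c * exp c * (n * n))"
          using mult_right_mono[OF e, of "n * n"] by simp
        also have "\<dots> \<le> 4 * real m * real k * real k ^ 2"
          using order_trans[OF tk m4] by (simp add: n_def power3_eq_cube power2_eq_square mult_ac)
        finally have "4 * n * real k ^ 2 \<le> real m * real k * real k ^ 2" by (simp add: mult_ac)
        moreover have "real k ^ 2 > 0" using k by simp
        ultimately show ?thesis by (rule mult_right_le_imp_le)
      qed
      moreover have "2 * n * (\<theta> + 1) = real m * real k / 2 + 2 * n"
        using n by (simp add: \<theta>_def field_simps)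
      ultimately have "2 * n * (\<theta> + 1) < real (Suc m) * real k"
        using k by (simp add: algebra_simps)
      then show "\<exists>K\<in>F. K \<in> extensions V k \<theta> (F - {K})"
        using exists_extension[OF V F \<theta>0] by (simp add: n_def)
    next
      fix F assume F: "F \<in> packings V k m"
      have "real (card (extensions V k \<theta> F)) \<le> ?B"
      proof (rule card_extensions_le[OF V F \<open>0 < m\<close> k(1) kn _ \<theta>0])
        \<comment> \<open>Since \<theta> n / exp c = m k / (4 exp c), this condition is k \<ge> 8
          exp c.\<close>
        have "8 * exp c * real m \<le> real k * real m" using c by (intro mult_right_mono) auto
        then show "2 * real m \<le> \<theta> * (real (card V) / exp c)"
          using n by (simp add: \<theta>_def n_def[symmetric] field_simps)
        \<comment> \<open>The constant 128 is 4 * 32: the 4 from t \<le> 4 m, and 32 = 2 * 4^2 from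
          the degree bound with this \<theta>.\<close>
        have "128 * c * exp c * n ^ 2 \<le> 4 * real m * real k ^ 3"
          using tk m4 by (simp add: n_def)
        then have "c \<le> real m * real k ^ 3 / (32 * exp c * n ^ 2)"
          using n by (simp add: field_simps)
        also have "\<dots> = real k / n * (\<theta>\<^sup>2 * (n / exp c) / (2 * real m))"
          using n \<open>m > 0\<close> by (simp add: \<theta>_def field_simps power2_eq_square power3_eq_cube)
        finally show "c \<le> real k / real (card V) * (\<theta>\<^sup>2 * (real (card V) / exp c) / (2 * real m))"
          by (simp add: n_def)
      qed (use c in auto)
      moreover have "finite (extensions V k \<theta> F)"
        using finite_imp_finite_nsets[OF V, of k] by (simp add: extensions_def)
      ultimately show "finite (extensions V k \<theta> F) \<and> real (card (extensions V k \<theta> F)) \<le> ?B"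
        by blast
    qed
  qed
  \<comment> \<open>Rounding down is harmless: t \<ge> 2 still gives t \<le> 4 h, so
    \<open>step\<close> applies from size h on.\<close>
  define h where "h = t div 2"
  have th: "t \<le> 4 * h" "h \<le> t" "real t / 2 \<le> real (t - h)" using t by (auto simp: h_def)
  have "real (card (packings V k (h + i))) \<le> real (card V choose k) ^ h * ?B ^ i" for i
  proof (induction i)
    case 0
    then show ?case using card_packings_le_power[OF V] by simp
  next
    case (Suc i)
    have "real (card (packings V k (h + Suc i))) \<le> real (card (packings V k (h + i))) * ?B"
      using step[of "h + i"] th by simp
    also have "\<dots> \<le> real (card V choose k) ^ h * ?B ^ i * ?B"
      using Suc by (intro mult_right_mono) auto
    finally show ?case by (simp add: mult_ac)
  qed
  from this[of "t - h"] have "real (card (packings V k t)) \<le> real (card V choose k) ^ h * ?B ^ (t - h)"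
    using th by simp
  also have "\<dots> = real (card V choose k) ^ t * exp ((3 - c / 2) * real k * real (t - h))"
    using th by (simp add: power_mult_distrib mult_ac flip: exp_of_nat_mult power_add)
  also have "\<dots> \<le> real (card V choose k) ^ t * exp ((3 - c / 2) * real k * (real t / 2))"
  proof -
    have "(3 - c / 2) * real k \<le> 0" using c by (intro mult_nonpos_nonneg) auto
    then have "(3 - c / 2) * real k * real (t - h) \<le> (3 - c / 2) * real k * (real t / 2)"
      using th(3) by (intro mult_left_mono_neg)
    then show ?thesis by (intro mult_left_mono) auto
  qed
  finally show ?thesis .
qed

section \<open>The union bound\<close>

lemma prob_random_graph_superset:
  assumes "X \<subseteq> nsets {1..n} 2"
  shows "measure_pmf.prob (random_graph n (1/2)) {E. X \<subseteq> E} = (1/2) ^ card X"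
proof -
  let ?N = "nsets {1..n} 2"
  let ?B = "\<lambda>e. if e \<in> X then {True} else UNIV"
  have fin: "finite ?N" by (simp add: finite_imp_finite_nsets)
  have "measure_pmf.prob (random_graph n (1/2)) {E. X \<subseteq> E}
      = measure_pmf.prob (Pi_pmf ?N False (\<lambda>_. bernoulli_pmf (1/2))) {\<omega>. X \<subseteq> {e \<in> ?N. \<omega> e}}"
    unfolding random_graph_def by (simp add: vimage_def)
  also have "{\<omega>. X \<subseteq> {e \<in> ?N. \<omega> e}} = Pi ?N ?B"
    using assms by (auto simp: Pi_def split: if_splits)
  also have "measure_pmf.prob (Pi_pmf ?N False (\<lambda>_. bernoulli_pmf (1/2))) (Pi ?N ?B)
      = (\<Prod>e\<in>?N. measure_pmf.prob (bernoulli_pmf (1/2)) (?B e))"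
    using fin by (rule measure_Pi_pmf_Pi)
  also have "\<dots> = (\<Prod>e\<in>?N. if e \<in> X then 1/2 else 1)"
    by (intro prod.cong) (auto simp: measure_pmf_single)
  also have "\<dots> = (1/2) ^ card X"
    using fin assms by (simp add: prod.If_cases Int_absorb1)
  finally show ?thesis .
qed

text \<open>The maximum is attained, and a subfamily of a packing is a packing, so the size can be
  cut to exactly t.\<close>

lemma clique_packing_number_geE:
  assumes V: "finite V" and t: "t \<le> clique_packing_number V E k"
  obtains F where "F \<in> packings V k t" "(\<Union>K\<in>F. nsets K 2) \<subseteq> E"
proof -
  let ?A = "{card F | F. F \<subseteq> k_cliques V E k \<and> pairwise edge_disjoint F}"
  have kV: "k_cliques V E k \<subseteq> nsets V k" by (auto simp: k_cliques_def)
  then have fin: "finite (k_cliques V E k)" using finite_imp_finite_nsets[OF V] finite_subset by blast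
  have "?A \<subseteq> card ` Pow (k_cliques V E k)" by auto
  then have "finite ?A" using fin finite_subset by blast
  moreover have "?A \<noteq> {}" by (auto intro!: exI[of _ "{}"])
  ultimately have "Max ?A \<in> ?A" by (rule Max_in)
  then obtain F where F: "F \<subseteq> k_cliques V E k" "pairwise edge_disjoint F"
    and "card F = clique_packing_number V E k"
    unfolding clique_packing_number_def by auto
  then obtain F' where F': "F' \<subseteq> F" "card F' = t"
    using t by (metis obtain_subset_with_card_n)
  show thesis
  proof
    show "F' \<in> packings V k t"
      using F F' kV unfolding packings_def by (auto intro: pairwise_mono)
    show "(\<Union>K\<in>F'. nsets K 2) \<subseteq> E"
    proof
      fix e assume "e \<in> (\<Union>K\<in>F'. nsets K 2)"
      then obtain K where K: "K \<in> F'" "e \<in> nsets K 2" by blast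
      then have "clique K E" using F F' by (auto simp: k_cliques_def)
      then show "e \<in> E" using K(2) by (auto simp: clique_def elim!: nsets2_E)
    qed
  qed
qed

lemma card_packing_edges:
  assumes V: "finite V" and F: "F \<in> packings V k t"
  shows "card (\<Union>K\<in>F. nsets K 2) = t * (k choose 2)"
proof -
  have *: "F \<subseteq> nsets V k" "pairwise edge_disjoint F" "card F = t"
    using F by (auto simp: packings_def)
  have K: "finite K" "card K = k" if "K \<in> F" for K using that * by (auto simp: nsets_def)
  have "card (\<Union>K\<in>F. nsets K 2) = (\<Sum>K\<in>F. card (nsets K 2))"
    using * K finite_packing[OF V F]
    by (intro card_UN_disjoint ballI finite_imp_finite_nsets)
      (auto simp: pairwise_def edge_disjoint_def)
  also have "\<dots> = (\<Sum>K\<in>F. k choose 2)" using K by (intro sum.cong) auto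
  finally show ?thesis using * by simp
qed

text \<open>Union bound over packings of exactly t sets; sharing no edges, they prescribe t (k
  choose 2) distinct edges.\<close>

lemma prob_clique_packing_number_ge:
  "measure_pmf.prob (random_graph n (1/2)) {E. t \<le> clique_packing_number {1..n} E k}
     \<le> real (card (packings {1..n} k t)) * (1/2) ^ (t * (k choose 2))"
proof -
  let ?P = "packings {1..n} k t" and ?M = "measure_pmf.prob (random_graph n (1/2))"
  let ?X = "\<lambda>F. {E. (\<Union>K\<in>F. nsets K 2) \<subseteq> E}"
  have "?M {E. t \<le> clique_packing_number {1..n} E k} \<le> ?M (\<Union>F\<in>?P. ?X F)"
    by (intro measure_pmf.finite_measure_mono) (auto elim!: clique_packing_number_geE[rotated])
  also have "\<dots> \<le> (\<Sum>F\<in>?P. ?M (?X F))"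
    by (intro measure_pmf.finite_measure_subadditive_finite finite_packings) auto
  also have "\<dots> = (\<Sum>F\<in>?P. (1/2) ^ (t * (k choose 2)))"
  proof (rule sum.cong)
    fix F assume F: "F \<in> ?P"
    have "(\<Union>K\<in>F. nsets K 2) \<subseteq> nsets {1..n} 2"
      using F by (auto simp: packings_def nsets_def)
    then show "?M (?X F) = (1/2) ^ (t * (k choose 2))"
      using prob_random_graph_superset card_packing_edges[OF _ F] by simp
  qed simp
  finally show ?thesis by simp
qed

section \<open>Expected clique counts near the threshold\<close>

lemma expected_cliques_eq: "expected_cliques n k = real (n choose k) * (1/2) ^ (k choose 2)"
  unfolding expected_cliques_def power_int_minus power_int_of_nat
  by (simp add: power_one_over inverse_eq_divide)

lemma expected_cliques_nonneg: "0 \<le> expected_cliques n k"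
  by (simp add: expected_cliques_eq)

text \<open>The ratio of consecutive values of f, cross-multiplied so that it also covers k \<ge>
  n.\<close>

lemma expected_cliques_Suc:
  "real (Suc k) * expected_cliques n (Suc k) * 2 ^ k = real (n - k) * expected_cliques n k"
proof -
  have "Suc k * (n choose Suc k) = (n - k) * (n choose k)"
    by (metis binomial_absorb_comp binomial_absorption)
  then have "real (Suc k) * real (n choose Suc k) = real (n - k) * real (n choose k)"
    by (metis of_nat_mult)
  moreover have "Suc k choose 2 = k + (k choose 2)"
    by (simp add: numeral_2_eq_2)
  ultimately show ?thesis
    by (simp add: expected_cliques_eq power_add power_one_over field_simps)
qed

section \<open>The threshold \<open>k_zero n\<close> has logarithmic order\<close>

lemma k_zero_props:
  shows k_zero_pos: "1 \<le> k_zero n" and expected_cliques_k_zero: "expected_cliques n (k_zero n) < 1"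
proof -
  have "1 \<le> Suc n \<and> expected_cliques n (Suc n) < 1" by (simp add: expected_cliques_eq binomial_eq_0)
  then have "1 \<le> k_zero n \<and> expected_cliques n (k_zero n) < 1"
    unfolding k_zero_def by (rule LeastI)
  then show "1 \<le> k_zero n" "expected_cliques n (k_zero n) < 1" by auto
qed

lemma two_times_choose_two: "2 * (k choose 2) = k * (k - 1)"
proof -
  have "even (k * (k - 1))" by (cases k) auto
  then show ?thesis by (simp add: choose_two)
qed

lemma square_le_two_power_Suc: "k\<^sup>2 \<le> (2::nat) ^ Suc k"
proof (induction k)
  case (Suc k)
  show ?case
  proof (cases "k < 3")
    case True
    then consider "k = 0" | "k = 1" | "k = 2" by linarith
    then show ?thesis by cases (simp_all add: power2_eq_square)
  next
    case False
    then have "3 * k \<le> k * k" by simp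
    then have "Suc (k + k) \<le> k * k" using False by linarith
    then have "(Suc k)\<^sup>2 \<le> 2 * k\<^sup>2" by (simp add: power2_eq_square)
    then show ?thesis using Suc by simp
  qed
qed simp

text \<open>If 2^k \<le> n, then (n/k)^2 \<ge> 4^k / k^2 \<ge> 2^(k-1), so (n choose k) \<ge>
  (n/k)^k \<ge> 2^(k choose 2) and f(k) \<ge> 1, which fails at the threshold.\<close>

lemma less_two_power_k_zero: "n < 2 ^ k_zero n"
proof (rule ccontr)
  define k where "k = k_zero n"
  assume "\<not> ?thesis"
  then have n: "2 ^ k \<le> n" by (simp add: k_def)
  have k: "0 < k" using k_zero_pos[of n] by (simp add: k_def)
  have kn: "k \<le> n" using n less_exp[of k] by linarith
  have "(real k)\<^sup>2 \<le> 2 ^ Suc k"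
    using square_le_two_power_Suc[of k] by (metis of_nat_le_iff of_nat_numeral of_nat_power)
  moreover have "(2::real) ^ (k - 1) * 2 ^ Suc k = (2 ^ k)\<^sup>2"
    using k by (cases k) (simp_all add: power2_eq_square power_add mult_ac)
  ultimately have "2 ^ (k - 1) * (real k)\<^sup>2 \<le> (2 ^ k)\<^sup>2"
    by (metis mult_left_mono zero_le_numeral zero_le_power)
  also have "(2 ^ k)\<^sup>2 \<le> (real n)\<^sup>2"
    using n by (intro power_mono) simp_all
  finally have "2 ^ (k - 1) \<le> (real n / real k)\<^sup>2"
    using k by (simp add: power_divide field_simps)
  then have "(2 ^ (k - 1)) ^ k \<le> ((real n / real k)\<^sup>2) ^ k" by (intro power_mono) auto
  moreover have "(k - 1) * k = 2 * (k choose 2)" using two_times_choose_two by (simp add: mult.commute)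
  ultimately have "(2 ^ (k choose 2))\<^sup>2 \<le> ((real n / real k) ^ k)\<^sup>2"
    by (simp flip: power_mult add: mult.commute)
  then have "2 ^ (k choose 2) \<le> (real n / real k) ^ k" by (rule power2_le_imp_le) auto
  also have "\<dots> \<le> real (n choose k)" using kn by (rule binomial_ge_n_over_k_pow_k)
  finally have "1 \<le> expected_cliques n k"
    by (simp add: expected_cliques_eq power_one_over field_simps)
  then show False using expected_cliques_k_zero[of n] by (simp add: k_def)
qed

text \<open>Minimality gives f(j) \<ge> 1 just below the threshold; with (n choose j) \<le> n^j this
  yields 2^(j-1) \<le> n^2.\<close>

lemma two_power_k_zero_le:
  assumes "0 < n"
  shows "2 ^ k_zero n \<le> 4 * n\<^sup>2"
proof (cases "k_zero n \<le> 2")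
  case True
  then have "(2::nat) ^ k_zero n \<le> 2 ^ 2" by (intro power_increasing) auto
  also have "\<dots> \<le> 4 * n\<^sup>2" using assms by simp
  finally show ?thesis .
next
  case False
  define j where "j = k_zero n - 1"
  have j: "1 \<le> j" "j < k_zero n" using False by (auto simp: j_def)
  have "1 \<le> expected_cliques n j"
    using j not_less_Least[of j "\<lambda>k. 1 \<le> k \<and> expected_cliques n k < 1"]
    unfolding k_zero_def by auto
  then have le: "2 ^ (j choose 2) \<le> real (n choose j)"
    by (simp add: expected_cliques_eq power_one_over field_simps)
  have "j \<le> n"
    using le by (metis binomial_eq_0 linorder_not_le of_nat_0 zero_less_numeral zero_less_power)
  then have "real (n choose j) \<le> real (n ^ j)" using binomial_le_pow of_nat_le_iff by blast
  from order_trans[OF le this] have "2 ^ (j choose 2) \<le> real n ^ j" by (simp only: of_nat_power)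
  then have "(2 ^ (j choose 2))\<^sup>2 \<le> (real n ^ j)\<^sup>2" by (intro power_mono) auto
  moreover have "(j - 1) * j = 2 * (j choose 2)" using two_times_choose_two by (simp add: mult.commute)
  ultimately have "(2 ^ (j - 1)) ^ j \<le> ((real n)\<^sup>2) ^ j"
    by (simp flip: power_mult add: mult.commute)
  then have "2 ^ (j - 1) \<le> (real n)\<^sup>2"
    using j by (meson less_eq_Suc_le order_less_le_trans power_mono_iff zero_le_numeral zero_le_power zero_le_power2 zero_less_one)
  then have "2 ^ (j - 1) \<le> n\<^sup>2"
    by (metis of_nat_le_iff of_nat_numeral of_nat_power)
  moreover have "k_zero n = (j - 1) + 2" using j by (simp add: j_def)
  ultimately show ?thesis by (simp add: power_add)
qed

lemma filterlim_k_zero: "filterlim k_zero at_top sequentially"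
  unfolding filterlim_at_top
proof
  fix Z
  show "\<forall>\<^sub>F n in sequentially. Z \<le> k_zero n"
    using eventually_ge_at_top[of "2 ^ Z"]
  proof eventually_elim
    case (elim n)
    then have "2 ^ Z < (2::nat) ^ k_zero n" using less_two_power_k_zero[of n] by linarith
    then show ?case by simp
  qed
qed

section \<open>Values of f on both sides of the threshold\<close>

lemma expected_cliques_le_1:
  assumes "k_zero n \<le> k"
  shows "expected_cliques n k \<le> 1"
  using assms
proof (induction k rule: dec_induct)
  case base
  then show ?case using expected_cliques_k_zero[of n] by simp
next
  case (step k)
  \<comment> \<open>Hence f(k+1) / f(k) = (n - k) / ((k+1) 2^k) is at most 1 from the threshold
    on.\<close>
  have "n < 2 ^ k"
    using less_two_power_k_zero[of n] power_increasing[OF step(1), of "2::nat"] by linarith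
  then have "n - k \<le> Suc k * 2 ^ k" by (simp add: trans_le_add1 le_diff_conv)
  then have "real (n - k) \<le> real (Suc k * 2 ^ k)" by (simp only: of_nat_le_iff)
  then have n: "real (n - k) \<le> real (Suc k) * 2 ^ k"
    by (simp only: of_nat_mult of_nat_power of_nat_numeral)
  have "real (Suc k) * 2 ^ k * expected_cliques n (Suc k) = real (n - k) * expected_cliques n k"
    using expected_cliques_Suc[of k n] by (simp add: mult_ac)
  also have "\<dots> \<le> real (Suc k) * 2 ^ k * 1"
    using n step expected_cliques_nonneg by (intro mult_mono) auto
  finally show ?case by (rule mult_left_le_imp_le) simp
qed

text \<open>As k + 1 \<le> n - k, each step down multiplies f by at most 2^k, hence by at most
  \<open>2 ^ k_zero n\<close>.\<close>

lemma expected_cliques_below: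
  assumes "2 * (k + c) \<le> n" and "k + c = k_zero n"
  shows "expected_cliques n k \<le> 2 ^ (c * k_zero n)"
  using assms
proof (induction c arbitrary: k)
  case 0
  then have "k = k_zero n" by (simp only: add_0_right)
  then have "expected_cliques n k < 1" by (simp only: expected_cliques_k_zero)
  then show ?case by simp
next
  case (Suc c)
  have "Suc k \<le> n - k" using Suc.prems(1) by simp
  then have "real (Suc k) \<le> real (n - k)" by (simp only: of_nat_le_iff)
  then have "real (Suc k) * expected_cliques n k \<le> real (n - k) * expected_cliques n k"
    using expected_cliques_nonneg by (intro mult_right_mono)
  also have "\<dots> = real (Suc k) * (expected_cliques n (Suc k) * 2 ^ k)"
    using expected_cliques_Suc[of k n] by simp
  also have "\<dots> \<le> real (Suc k) * (2 ^ (c * k_zero n) * 2 ^ k_zero n)"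
    using Suc by (intro mult_left_mono mult_mono) (auto intro: power_increasing expected_cliques_nonneg)
  finally have "expected_cliques n k \<le> 2 ^ (c * k_zero n) * 2 ^ k_zero n"
    by (rule mult_left_le_imp_le) simp
  then show ?case by (simp add: power_add mult.commute)
qed

section \<open>The packing number\<close>

lemma prob_clique_packing_number_less:
  fixes n k a :: nat and c :: real
  assumes c: "c = 8 * real a + 10" "8 * exp c \<le> real k"
    and k: "0 < k" "real k ^ 2 \<le> real n"
    and f: "expected_cliques n k \<le> exp (2 * real a * real k)"
  shows "measure_pmf.prob (random_graph n (1/2))
           {E. real (clique_packing_number {1..n} E k) > 128 * c * exp c * real n ^ 2 / real k ^ 3}
         < exp (- (real n ^ 2 / real k ^ 2))"
proof -
  let ?M = "measure_pmf.prob (random_graph n (1/2))"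
  define x where "x = 128 * c * exp c * real n ^ 2 / real k ^ 3"
  \<comment> \<open>The least integer above x, so a packing number exceeding x is at least
    t.\<close>
  define t where "t = nat \<lfloor>x\<rfloor> + 1"
  have "1 * 1 \<le> c * exp c" using c by (intro mult_mono) auto
  then have "128 * 1 \<le> 128 * (c * exp c)" by (intro mult_left_mono) auto
  then have c1: "1 \<le> 128 * c * exp c" by simp
  have "1 * real k ^ 3 \<le> real k * real k ^ 3" using k by (intro mult_right_mono) auto
  also have "\<dots> = (real k ^ 2)\<^sup>2" by (simp flip: power_mult power_Suc)
  also have "\<dots> \<le> (real n)\<^sup>2" using k by (intro power_mono) auto
  \<comment> \<open>This forces x \<ge> 1 and hence t \<ge> 2, as \<open>card_packings_le\<close>
    requires.\<close>
  finally have nk: "1 \<le> (real n)\<^sup>2 / real k ^ 3" using k by simp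
  have x: "(real n)\<^sup>2 / real k ^ 3 \<le> x"
    using mult_right_mono[OF c1, of "(real n)\<^sup>2 / real k ^ 3"] by (simp add: x_def)
  then have x1: "1 \<le> x" using nk by linarith
  then have t2: "2 \<le> t" unfolding t_def by (simp add: le_nat_iff)
  have tx: "x < real t" using x1 unfolding t_def by linarith
  have "{E. real (clique_packing_number {1..n} E k) > x} \<subseteq> {E. t \<le> clique_packing_number {1..n} E k}"
    unfolding t_def using x1 by (auto simp: Suc_le_eq nat_less_iff floor_less_iff)
  then have "?M {E. real (clique_packing_number {1..n} E k) > x}
      \<le> ?M {E. t \<le> clique_packing_number {1..n} E k}"
    by (intro measure_pmf.finite_measure_mono) auto
  also have "\<dots> \<le> real (card (packings {1..n} k t)) * (1/2) ^ (t * (k choose 2))"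
    by (rule prob_clique_packing_number_ge)
  also have "\<dots> \<le> real (n choose k) ^ t * exp ((3 - c / 2) * real k * (real t / 2))
      * (1/2) ^ (t * (k choose 2))"
  proof (rule mult_right_mono)
    have "x * real k ^ 3 \<le> real t * real k ^ 3" using tx by (intro mult_right_mono) auto
    then have "128 * c * exp c * real n ^ 2 \<le> real t * real k ^ 3" using k by (simp add: x_def)
    then show "real (card (packings {1..n} k t))
        \<le> real (n choose k) ^ t * exp ((3 - c / 2) * real k * (real t / 2))"
      using card_packings_le[of "{1..n}" k t c] k t2 c by simp
  qed simp
  also have "\<dots> = expected_cliques n k ^ t * exp ((3 - c / 2) * real k * (real t / 2))"
    by (simp add: expected_cliques_eq power_mult_distrib mult.commute flip: power_mult)
  also have "\<dots> \<le> exp (2 * real a * real k) ^ t * exp ((3 - c / 2) * real k * (real t / 2))"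
    using f expected_cliques_nonneg by (intro mult_right_mono power_mono) auto
  also have "\<dots> = exp (real t * (2 * real a * real k) + (3 - c / 2) * real k * (real t / 2))"
    by (simp add: exp_add exp_of_nat_mult)
  \<comment> \<open>The choice c = 8 a + 10 makes the loss 2 a k t from f(k)^t and the gain add up
    to exactly - k t.\<close>
  also have "real t * (2 * real a * real k) + (3 - c / 2) * real k * (real t / 2) = - (real k * real t)"
    by (simp add: c field_simps)
  also have "exp (- (real k * real t)) < exp (- (real n ^ 2 / real k ^ 2))"
  proof -
    have "(real n)\<^sup>2 / real k ^ 2 = real k * ((real n)\<^sup>2 / real k ^ 3)"
      using k by (simp add: power2_eq_square power3_eq_cube)
    also have "\<dots> < real k * real t" using k x tx by (intro mult_strict_left_mono) auto
    finally show ?thesis by simp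
  qed
  finally show ?thesis by (simp add: x_def)
qed

theorem theorem1p2:
  fixes C :: int
  shows "\<exists>D::real. \<forall>\<^sub>F n in sequentially. \<forall>k::nat. int k = int (k_zero n) - C \<longrightarrow>
           measure_pmf.prob (random_graph n (1/2))
             {E. real (clique_packing_number {1..n} E k) > D * real n ^ 2 / real k ^ 3}
           < exp (- (real n ^ 2 / real k ^ 2))"
proof -
  \<comment> \<open>The absolute value treats both signs of \<open>C\<close> at once; D will be 128
    c exp c.\<close>
  define a where "a = nat \<bar>C\<bar>"
  define c where "c = 8 * real a + 10"
  \<comment> \<open>With m = \<open>k_zero n\<close>, the first condition and 2^m \<le> 4 n^2 give 4
    m^2 \<le> n; the second makes k and m agree within a factor 2; the third then gives k \<ge> 8
    exp c.\<close>
  have "\<forall>\<^sub>F m in sequentially. 64 * real m ^ 4 \<le> 2 ^ m" by real_asymp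
  moreover have "\<forall>\<^sub>F m in sequentially. 2 * real a + 1 \<le> real m" by real_asymp
  moreover have "\<forall>\<^sub>F m in sequentially. 16 * exp c \<le> real m" by real_asymp
  ultimately have "\<forall>\<^sub>F m in sequentially.
      64 * real m ^ 4 \<le> 2 ^ m \<and> 2 * a + 1 \<le> m \<and> 16 * exp c \<le> real m"
    by eventually_elim linarith
  then have ev: "\<forall>\<^sub>F n in sequentially. 64 * real (k_zero n) ^ 4 \<le> 2 ^ k_zero n \<and>
      2 * a + 1 \<le> k_zero n \<and> 16 * exp c \<le> real (k_zero n)"
    by (rule eventually_compose_filterlim[OF _ filterlim_k_zero])
  have "\<forall>\<^sub>F n in sequentially. \<forall>k::nat. int k = int (k_zero n) - C \<longrightarrow>
           measure_pmf.prob (random_graph n (1/2))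
             {E. real (clique_packing_number {1..n} E k) > (128 * c * exp c) * real n ^ 2 / real k ^ 3}
           < exp (- (real n ^ 2 / real k ^ 2))"
    using ev eventually_gt_at_top[of 0]
  proof eventually_elim
    case (elim n)
    let ?K = "k_zero n"
    have "real (2 ^ ?K) \<le> real (4 * n\<^sup>2)"
      using two_power_k_zero_le[OF elim(2)] by (simp only: of_nat_le_iff)
    then have "(2::real) ^ ?K \<le> 4 * (real n)\<^sup>2"
      by (simp only: of_nat_mult of_nat_power of_nat_numeral)
    then have "64 * real ?K ^ 4 \<le> 4 * (real n)\<^sup>2" using elim(1) by linarith
    then have "(4 * real ?K ^ 2)\<^sup>2 \<le> (real n)\<^sup>2"
      by (simp add: power_mult_distrib flip: power_mult)
    then have n: "4 * real ?K ^ 2 \<le> real n" by (rule power2_le_imp_le) simp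
    show ?case
    proof (intro allI impI)
      fix k :: nat
      assume k: "int k = int ?K - C"
      have k2: "?K \<le> 2 * k" "k \<le> 2 * ?K" "0 < k" using k elim by (auto simp: a_def)
      have "real ?K * 1 \<le> real ?K * real ?K" using elim by (intro mult_left_mono) auto
      then have "real (2 * ?K) \<le> real n" using n by (simp add: power2_eq_square)
      then have K: "2 * ?K \<le> n" by (simp only: of_nat_le_iff)
      have "expected_cliques n k \<le> 2 ^ (a * ?K)"
      proof (cases "0 \<le> C")
        case True
        then have ka: "k + a = ?K" using k by (simp add: a_def)
        show ?thesis by (rule expected_cliques_below[OF _ ka]) (use K ka in simp)
      next
        case False
        then have "expected_cliques n k \<le> 1" using k by (intro expected_cliques_le_1) simp
        also have "1 \<le> (2::real) ^ (a * ?K)" by simp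
        finally show ?thesis .
      qed
      also have "\<dots> \<le> exp 1 ^ (a * ?K)"
        using exp_ge_add_one_self[of 1] by (intro power_mono) auto
      also have "\<dots> = exp (real a * real ?K)" by (simp flip: exp_of_nat_mult)
      also have "\<dots> \<le> exp (2 * real a * real k)"
        using mult_left_mono[of "real ?K" "2 * real k" "real a"] k2 by simp
      finally have f: "expected_cliques n k \<le> exp (2 * real a * real k)" .
      have "real k ^ 2 \<le> (2 * real ?K) ^ 2" using k2 by (intro power_mono) auto
      also have "\<dots> \<le> real n" using n by (simp add: power_mult_distrib)
      finally have "real k ^ 2 \<le> real n" .
      moreover have "8 * exp c \<le> real k" using elim k2 by linarith
      ultimately show "measure_pmf.prob (random_graph n (1/2))
           {E. real (clique_packing_number {1..n} E k) > (128 * c * exp c) * real n ^ 2 / real k ^ 3}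
         < exp (- (real n ^ 2 / real k ^ 2))"
        using prob_clique_packing_number_less[OF c_def _ k2(3) _ f] by blast
    qed
  qed
  then show ?thesis by blast
qed

end
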